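(* The sequence $\{v_n(\cdot,\cdot)\}_{n\ge0}$ converges uniformly to $v_\infty$. In fact, the rate of convergence is exponential: $$v_n(x,T)\le v_\infty(x,T)\le v_n(x,T)+\Big(\frac{\lambda}{\lambda+r}\Big)^nK,\qquad (x,T)\in\mathbb{R}_+\times\bar{\mathbb{R}}_+.$$
   Context: Notation: $\mathbb{R}_+=[0,\infty)$, $\bar{\mathbb{R}}_+=[0,\infty]$. The constants are the interest rate $r\ge0$, the volatility $\sigma>0$, the jump intensity $\lambda>0$ and the strike $K>0$; $\nu$ is a probability measure on $\mathbb{R}_+$, the law of a positive random variable, with $\xi:=\int_{\mathbb{R}_+}x\,\nu(dx)<\infty$, and $\mu=r+\lambda-\lambda\xi$. Let $W$ be a Wiener process, $H_t=\exp\{(\mu-\frac12\sigma^2)t+\sigma W_t\}$, $S^0_t=xH_t$, and let $\mathcal{S}_{0,T}$ be the set of stopping times of $S^0$ with values in $[0,T]$. For a nonnegative function $f$ put $$Pf(x,T)=\int_{\mathbb{R}_+}f(xz,T)\,\nu(dz),$$ $$Jf(x,T)=\sup_{\tau\in\mathcal{S}_{0,T}}\mathbb{E}\Big\{\int_0^\tau e^{-(r+\lambda)t}\lambda\,Pf(xH_t,T-t)\,dt+e^{-(r+\lambda)\tau}(K-xH_\tau)^+\Big\}.$$ Define $v_0(x,T)=(K-x)^+$ and $v_{n+1}(x,T)=Jv_n(x,T)$, $n\ge0$, for $(x,T)\in\mathbb{R}_+\times\mathbb{R}_+$, and extend these functions to $T=\infty$ by $v_n(x,\infty)=\lim_{T\to\infty}v_n(x,T)$.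 Put $v_\infty(x,T)=\sup_{n\ge0}v_n(x,T)$ for $(x,T)\in\mathbb{R}_+\times\bar{\mathbb{R}}_+$.
   Formalization: Uniform convergence on all of R_+ × [0,∞] is stated only for r > 0; for r = 0, where it fails (v_∞(x,∞) = K for all x while v_n(x,∞) → 0 as x → ∞), it is stated on R_+ × [0,T_0] for each finite T_0; the displayed bound is unchanged. *)

theory Defs
  imports "HOL-Probability.Probability"
begin

(* W is only looked at for times t >= 0. *)
locale wiener_process = prob_space M for M :: "'a measure" +
  fixes W :: "real \<Rightarrow> 'a \<Rightarrow> real"
  assumes random_variable_W: "0 \<le> t \<Longrightarrow> random_variable borel (W t)"
    and start_W: "AE \<omega> in M. W 0 \<omega> = 0"
    and continuous_W: "\<omega> \<in> space M \<Longrightarrow> continuous_on {0..} (\<lambda>t. W t \<omega>)"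
    and gaussian_increments_W: "0 \<le> s \<Longrightarrow> s < t \<Longrightarrow>
          distributed M lborel (\<lambda>\<omega>. W t \<omega> - W s \<omega>) (normal_density 0 (sqrt (t - s)))"
    and indep_increments_W: "0 \<le> ts 0 \<Longrightarrow> strict_mono ts \<Longrightarrow>
          indep_vars (\<lambda>_. borel) (\<lambda>i \<omega>. W (ts (Suc i)) \<omega> - W (ts i) \<omega>) {..<n :: nat}"

(* The raw filtration sigma(X s, 0 <= s <= t), trivial for t < 0. *)
definition natural_filtration :: "'a measure \<Rightarrow> (real \<Rightarrow> 'a \<Rightarrow> real) \<Rightarrow> real \<Rightarrow> 'a measure" where
  "natural_filtration M X t =
     sigma (space M) {X s -` B \<inter> space M | s B. s \<in> {0..t} \<and> B \<in> sets borel}"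

definition stopping_times :: "'a measure \<Rightarrow> (real \<Rightarrow> 'a \<Rightarrow> real) \<Rightarrow> real \<Rightarrow> ('a \<Rightarrow> real) set" where
  "stopping_times M X T =
     {\<tau>. stopping_time (natural_filtration M X) \<tau> \<and> (\<forall>\<omega>\<in>space M. \<tau> \<omega> \<in> {0..T})}"

definition jump_mean :: "real measure \<Rightarrow> real" where
  "jump_mean \<nu> = (LINT z:{0..}|\<nu>. z)"

definition drift :: "real measure \<Rightarrow> real \<Rightarrow> real \<Rightarrow> real" where
  "drift \<nu> r lam = r + lam - lam * jump_mean \<nu>"

definition H_proc :: "(real \<Rightarrow> 'a \<Rightarrow> real) \<Rightarrow> real \<Rightarrow> real \<Rightarrow> real \<Rightarrow> 'a \<Rightarrow> real" where
  "H_proc W \<mu> \<sigma> t \<omega> = exp ((\<mu> - \<sigma>\<^sup>2 / 2) * t + \<sigma> * W t \<omega>)"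

(* Nonnegative functions of (x, T) are ennreal-valued, and their integrals are nn_integral. *)
definition P_op :: "real measure \<Rightarrow> (real \<Rightarrow> real \<Rightarrow> ennreal) \<Rightarrow> real \<Rightarrow> real \<Rightarrow> ennreal" where
  "P_op \<nu> f x T = (\<integral>\<^sup>+z\<in>{0..}. f (x * z) T \<partial>\<nu>)"

definition put_payoff :: "real \<Rightarrow> real \<Rightarrow> real" where
  "put_payoff K x = max 0 (K - x)"

definition J_op ::
  "'a measure \<Rightarrow> (real \<Rightarrow> 'a \<Rightarrow> real) \<Rightarrow> real measure \<Rightarrow> real \<Rightarrow> real \<Rightarrow> real \<Rightarrow> real \<Rightarrow>
     (real \<Rightarrow> real \<Rightarrow> ennreal) \<Rightarrow> real \<Rightarrow> real \<Rightarrow> ennreal" where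
  "J_op M W \<nu> r \<sigma> lam K f x T =
     (let H = H_proc W (drift \<nu> r lam) \<sigma> in
      SUP \<tau>\<in>stopping_times M (\<lambda>t \<omega>. x * H t \<omega>) T.
        \<integral>\<^sup>+\<omega>. ((\<integral>\<^sup>+t\<in>{0..\<tau> \<omega>}. ennreal (exp (- (r + lam) * t) * lam) * P_op \<nu> f (x * H t \<omega>) (T - t) \<partial>lborel)
              + ennreal (exp (- (r + lam) * \<tau> \<omega>) * put_payoff K (x * H (\<tau> \<omega>) \<omega>))) \<partial>M)"

fun v_finite ::
  "'a measure \<Rightarrow> (real \<Rightarrow> 'a \<Rightarrow> real) \<Rightarrow> real measure \<Rightarrow> real \<Rightarrow> real \<Rightarrow> real \<Rightarrow> real \<Rightarrow>
     nat \<Rightarrow> real \<Rightarrow> real \<Rightarrow> ennreal" where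
  "v_finite M W \<nu> r \<sigma> lam K 0 = (\<lambda>x T. ennreal (put_payoff K x))"
| "v_finite M W \<nu> r \<sigma> lam K (Suc n) = J_op M W \<nu> r \<sigma> lam K (v_finite M W \<nu> r \<sigma> lam K n)"

(* The extension to maturities in [0, \<infinity>]; here the type ennreal is the set of maturities. *)
definition v ::
  "'a measure \<Rightarrow> (real \<Rightarrow> 'a \<Rightarrow> real) \<Rightarrow> real measure \<Rightarrow> real \<Rightarrow> real \<Rightarrow> real \<Rightarrow> real \<Rightarrow>
     nat \<Rightarrow> real \<Rightarrow> ennreal \<Rightarrow> ennreal" where
  "v M W \<nu> r \<sigma> lam K n x T =
     (if T = \<infinity> then Lim at_top (v_finite M W \<nu> r \<sigma> lam K n x)
      else v_finite M W \<nu> r \<sigma> lam K n x (enn2real T))"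

definition v_inf ::
  "'a measure \<Rightarrow> (real \<Rightarrow> 'a \<Rightarrow> real) \<Rightarrow> real measure \<Rightarrow> real \<Rightarrow> real \<Rightarrow> real \<Rightarrow> real \<Rightarrow>
     real \<Rightarrow> ennreal \<Rightarrow> ennreal" where
  "v_inf M W \<nu> r \<sigma> lam K x T = (SUP n. v M W \<nu> r \<sigma> lam K n x T)"

end

theory Submission
  imports Defs
begin

text \<open>
  An error \<open>c\<close> in \<open>f\<close> becomes in \<open>J f\<close> an error of at most
  \<open>c \<integral>\<^sub>0\<^sup>T exp (- (r + \<lambda>) t) \<lambda> dt = (\<lambda> / (\<lambda> + r)) (1 - exp (- (r + \<lambda>) T)) c\<close>, as stopping
  happens before \<open>T\<close>. All iterates are bounded by \<open>K\<close>, so \<open>v\<^sub>m \<le> v\<^sub>0 + K\<close>, and \<open>n\<close> applications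
  of \<open>J\<close> give \<open>v\<^sub>m\<^sub>+\<^sub>n \<le> v\<^sub>n + (\<lambda> / (\<lambda> + r))\<^sup>n K\<close>. The factor depending on \<open>T\<close> yields uniform
  convergence on bounded maturities also for \<open>r = 0\<close>. Maturity \<open>\<infinity>\<close> is reached through
  monotonicity in \<open>T\<close>.

  Measurability of \<open>v\<^sub>n\<close>, a supremum over an uncountable family, is never needed: for an arbitrary
  integrand \<open>nn_integral\<close> is a lower integral, which is still monotone and still subadditive as
  soon as one of the summands is measurable.
\<close>

section \<open>Lower integrals, the discount integral, and uniform limits from geometric
  bounds\<close>

text \<open>A simple function \<open>h\<close> below \<open>f + g\<close> is at most
  \<open>(h - g) + g\<close>. Here \<open>h - g\<close> is measurable and lies below
  \<open>f\<close>, so exact additivity is applied only to the measurable pair \<open>h - g\<close>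
  and \<open>g\<close>.\<close>

lemma nn_integral_add_le:
  fixes f g :: "'a \<Rightarrow> ennreal"
  assumes g [measurable]: "g \<in> borel_measurable M" and fin: "\<And>x. g x < \<infinity>"
  shows "(\<integral>\<^sup>+x. f x + g x \<partial>M) \<le> (\<integral>\<^sup>+x. f x \<partial>M) + (\<integral>\<^sup>+x. g x \<partial>M)"
proof -
  have "integral\<^sup>S M h \<le> (\<integral>\<^sup>+x. f x \<partial>M) + (\<integral>\<^sup>+x. g x \<partial>M)"
    if h: "simple_function M h" "h \<le> (\<lambda>x. f x + g x)" for h
  proof -
    have [measurable]: "h \<in> borel_measurable M"
      using h(1) by (rule borel_measurable_simple_function)
    have "integral\<^sup>S M h = (\<integral>\<^sup>+x. h x \<partial>M)"
      using h(1) by (simp add: nn_integral_eq_simple_integral)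
    also have "\<dots> \<le> (\<integral>\<^sup>+x. (h x - g x) + g x \<partial>M)"
      by (intro nn_integral_mono) (metis add.commute ennreal_minus_le_iff fin less_irrefl order_refl)
    also have "\<dots> = (\<integral>\<^sup>+x. h x - g x \<partial>M) + (\<integral>\<^sup>+x. g x \<partial>M)"
      by (intro nn_integral_add) auto
    also have "(\<integral>\<^sup>+x. h x - g x \<partial>M) \<le> (\<integral>\<^sup>+x. f x \<partial>M)"
    proof (intro nn_integral_mono)
      fix x
      \<comment> \<open>Finiteness of \<open>g\<close> matters: in \<open>ennreal\<close> the
        difference \<open>top - top\<close> is \<open>top\<close>, which need not lie below
        \<open>f x\<close>.\<close>
      show "h x - g x \<le> f x"
        using h(2) fin[of x] by (auto simp: le_fun_def ennreal_minus_le_iff add.commute)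
    qed
    finally show ?thesis by (simp add: add_right_mono)
  qed
  then show ?thesis
    unfolding nn_integral_def[of M "\<lambda>x. f x + g x"] by (intro SUP_least) auto
qed

text \<open>For \<open>a = r + lam\<close> and \<open>b = lam\<close> this is the present value of
  one unit paid at an exponential time of rate \<open>lam\<close> if that time comes by
  \<open>s\<close>. It becomes the contraction factor of J.\<close>

lemma nn_integral_exp_discount:
  fixes a b s :: real
  assumes "0 < a" "0 \<le> b" "0 \<le> s"
  shows "(\<integral>\<^sup>+t\<in>{0..s}. ennreal (exp (- a * t) * b) \<partial>lborel)
    = ennreal (b / a * (1 - exp (- a * s)))"
proof -
  have "(\<integral>\<^sup>+t\<in>{0..s}. ennreal (exp (- a * t) * b) \<partial>lborel)
    = ennreal ((- b / a * exp (- a * s)) - (- b / a * exp (- a * 0)))"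
    using assms by (intro nn_integral_FTC_Icc) (auto intro!: derivative_eq_intros)
  also have "(- b / a * exp (- a * s)) - (- b / a * exp (- a * 0)) = b / a * (1 - exp (- a * s))"
    by (simp add: algebra_simps)
  finally show ?thesis .
qed

text \<open>The error \<open>q ^ n * K\<close> does not depend on \<open>y\<close> and tends to 0.
  Passing to reals loses nothing, because \<open>g\<close> is finite on \<open>S\<close> and
  dominates every \<open>f n\<close>.\<close>

lemma uniform_limit_enn2real_geometric:
  fixes f :: "nat \<Rightarrow> 'b \<Rightarrow> ennreal" and q K :: real
  assumes q: "0 \<le> q" "q < 1" and K: "0 \<le> K"
    and fin: "\<And>y. y \<in> S \<Longrightarrow> g y < \<infinity>"
    and le: "\<And>n y. y \<in> S \<Longrightarrow> f n y \<le> g y"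
    and ge: "\<And>n y. y \<in> S \<Longrightarrow> g y \<le> f n y + ennreal (q ^ n * K)"
  shows "uniform_limit S (\<lambda>n y. enn2real (f n y)) (\<lambda>y. enn2real (g y)) sequentially"
proof (rule uniform_limitI)
  fix e :: real
  assume "0 < e"
  have "(\<lambda>n. q ^ n * K) \<longlonglongrightarrow> 0 * K"
    using q by (intro tendsto_mult tendsto_const LIMSEQ_realpow_zero)
  then have "\<forall>\<^sub>F n in sequentially. q ^ n * K < e"
    using \<open>0 < e\<close> by (intro order_tendstoD) auto
  then show "\<forall>\<^sub>F n in sequentially. \<forall>y\<in>S. dist (enn2real (f n y)) (enn2real (g y)) < e"
  proof eventually_elim
    case (elim n)
    show ?case
    proof
      fix y
      assume y: "y \<in> S"
      have f: "f n y < \<infinity>"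
        using le[OF y] fin[OF y] by (rule le_less_trans)
      have 1: "enn2real (f n y) \<le> enn2real (g y)"
        using le[OF y] fin[OF y] by (intro enn2real_mono) auto
      \<comment> \<open>\<open>enn2real\<close> sends infinity to 0, so it is monotone only below a
        finite bound; finiteness of \<open>f n y\<close> supplies that bound.\<close>
      have "enn2real (g y) \<le> enn2real (f n y + ennreal (q ^ n * K))"
        using ge[OF y] f by (intro enn2real_mono) auto
      also have "\<dots> = enn2real (f n y) + q ^ n * K"
        using f q K by (subst enn2real_plus) auto
      finally show "dist (enn2real (f n y)) (enn2real (g y)) < e"
        using 1 elim by (simp add: dist_real_def)
    qed
  qed
qed

section \<open>Elementary bounds for the payoff, the stopping times and the operator P\<close>

lemma put_payoff_le: "0 \<le> x \<Longrightarrow> 0 \<le> K \<Longrightarrow> put_payoff K x \<le> K"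
  by (auto simp: put_payoff_def)

lemma H_proc_pos: "0 < H_proc W \<mu> \<sigma> t \<omega>"
  by (simp add: H_proc_def)

lemma stopping_times_mono: "T \<le> T' \<Longrightarrow> stopping_times M X T \<subseteq> stopping_times M X T'"
  by (fastforce simp: stopping_times_def)

text \<open>A constant error passes through P because \<nu> has total mass 1. The maturities
  \<open>T\<close> and \<open>T'\<close> are separate so that the lemma also serves the shift in
  maturity.\<close>

lemma P_op_add_le:
  assumes \<nu>: "prob_space \<nu>" "sets \<nu> = sets borel" and "0 \<le> x" and "c < \<infinity>"
    and le: "\<And>y. 0 \<le> y \<Longrightarrow> f y T \<le> g y T' + c"
  shows "P_op \<nu> f x T \<le> P_op \<nu> g x T' + c"
proof -
  interpret \<nu>: prob_space \<nu> by fact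
  have [measurable]: "{0::real..} \<in> sets \<nu>"
    by (simp add: \<nu>(2))
  have "P_op \<nu> f x T \<le> (\<integral>\<^sup>+z. g (x * z) T' * indicator {0..} z + c * indicator {0..} z \<partial>\<nu>)"
    unfolding P_op_def using le \<open>0 \<le> x\<close>
    by (intro nn_integral_mono) (auto simp: indicator_def)
  also have "\<dots> \<le> P_op \<nu> g x T' + (\<integral>\<^sup>+z. c * indicator {0..} z \<partial>\<nu>)"
    unfolding P_op_def using \<open>c < \<infinity>\<close>
    by (intro nn_integral_add_le) (auto simp: indicator_def)
  also have "(\<integral>\<^sup>+z. c * indicator {0..} z \<partial>\<nu>) \<le> (\<integral>\<^sup>+z. c \<partial>\<nu>)"
    by (intro nn_integral_mono) (auto simp: indicator_def)
  also have "\<dots> = c"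
    by (simp add: \<nu>.emeasure_space_1)
  finally show ?thesis by (simp add: add_left_mono)
qed

lemma P_op_le:
  assumes "prob_space \<nu>" and "0 \<le> x" and le: "\<And>y. 0 \<le> y \<Longrightarrow> f y T \<le> c"
  shows "P_op \<nu> f x T \<le> c"
proof -
  interpret \<nu>: prob_space \<nu> by fact
  have "P_op \<nu> f x T \<le> (\<integral>\<^sup>+z. c \<partial>\<nu>)"
    unfolding P_op_def using le \<open>0 \<le> x\<close>
    by (intro nn_integral_mono) (auto simp: indicator_def)
  also have "\<dots> = c"
    by (simp add: \<nu>.emeasure_space_1)
  finally show ?thesis .
qed

section \<open>The operator J: propagation of errors, upper bound and lower bound\<close>

context
  fixes M :: "'a measure" and W :: "real \<Rightarrow> 'a \<Rightarrow> real" and \<nu> :: "real measure"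
    and r \<sigma> lam K :: real
  assumes W: "wiener_process M W"
    and \<nu>: "prob_space \<nu>" "sets \<nu> = sets borel"
    and r: "0 \<le> r" and lam: "0 < lam" and K: "0 < K"
begin

interpretation wiener_process M W by (fact W)

lemma discount_le_one: "0 \<le> t \<Longrightarrow> exp (- (r + lam) * t) \<le> 1"
  using r lam by (subst exp_le_one_iff) (intro mult_nonpos_nonneg, auto)

lemma discount_antimono: "s \<le> t \<Longrightarrow> exp (- (r + lam) * t) \<le> exp (- (r + lam) * s)"
  using r lam by (subst exp_le_cancel_iff) (intro mult_left_mono_neg, auto)

lemma discount_factor_nonneg:
  "0 \<le> T \<Longrightarrow> 0 \<le> lam / (lam + r) * (1 - exp (- (r + lam) * T))"
  using r lam discount_le_one[of T] by (intro mult_nonneg_nonneg) auto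

lemma discount_factor_le: "lam / (lam + r) * (1 - exp (- (r + lam) * T)) \<le> lam / (lam + r)"
  using r lam by (intro mult_left_le) auto

text \<open>The shift \<open>T' - T\<close> makes this contain both the contraction property (\<open>T' = T\<close>) and the
  monotonicity in the maturity (\<open>c = 0\<close>).\<close>

lemma J_op_add_le:
  fixes c :: real
  assumes x: "0 \<le> x" and T: "T \<le> T'" "T \<le> T0" and c: "0 \<le> c"
    and le: "\<And>y s. 0 \<le> y \<Longrightarrow> 0 \<le> s \<Longrightarrow> s \<le> T \<Longrightarrow> f y s \<le> g y (s + (T' - T)) + ennreal c"
  shows "J_op M W \<nu> r \<sigma> lam K f x T \<le> J_op M W \<nu> r \<sigma> lam K g x T'
    + ennreal (lam / (lam + r) * (1 - exp (- (r + lam) * T0)) * c)"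
proof -
  define H where "H = H_proc W (drift \<nu> r lam) \<sigma>"
  define D where "D = (\<lambda>t. ennreal (exp (- (r + lam) * t) * lam))"
  define C where "C = ennreal (lam / (lam + r) * (1 - exp (- (r + lam) * T0)) * c)"
  \<comment> \<open>The running reward \<open>I\<close> alone depends on the integrand and the
    maturity. The stopping reward \<open>S\<close> is the same on both sides of the
    comparison.\<close>
  define I where "I = (\<lambda>f \<tau> T \<omega>. \<integral>\<^sup>+t\<in>{0..\<tau> \<omega>}. D t * P_op \<nu> f (x * H t \<omega>) (T - t) \<partial>lborel)"
  define S where "S = (\<lambda>\<tau> \<omega>. ennreal (exp (- (r + lam) * \<tau> \<omega>) * put_payoff K (x * H (\<tau> \<omega>) \<omega>)))"
  have [measurable]: "D \<in> borel_measurable borel"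
    unfolding D_def by measurable
  have J: "J_op M W \<nu> r \<sigma> lam K f x T
      = (SUP \<tau>\<in>stopping_times M (\<lambda>t \<omega>. x * H t \<omega>) T. \<integral>\<^sup>+\<omega>. (I f \<tau> T \<omega> + S \<tau> \<omega>) \<partial>M)" for f T
    by (simp add: J_op_def I_def S_def H_def D_def Let_def)
  have "(\<integral>\<^sup>+\<omega>. (I f \<tau> T \<omega> + S \<tau> \<omega>) \<partial>M) \<le> J_op M W \<nu> r \<sigma> lam K g x T' + C"
    if \<tau>: "\<tau> \<in> stopping_times M (\<lambda>t \<omega>. x * H t \<omega>) T" for \<tau>
  proof -
    have I: "I f \<tau> T \<omega> \<le> I g \<tau> T' \<omega> + C" if \<omega>: "\<omega> \<in> space M" for \<omega>
    proof -
      have \<tau>\<omega>: "0 \<le> \<tau> \<omega>" "\<tau> \<omega> \<le> T"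
        using \<tau> \<omega> by (auto simp: stopping_times_def)
      have P: "P_op \<nu> f (x * H t \<omega>) (T - t) \<le> P_op \<nu> g (x * H t \<omega>) (T' - t) + ennreal c"
        if "0 \<le> t" "t \<le> \<tau> \<omega>" for t
      proof (intro P_op_add_le \<nu>)
        show "0 \<le> x * H t \<omega>"
          using x H_proc_pos[of W "drift \<nu> r lam" \<sigma> t \<omega>] by (simp add: H_def)
        \<comment> \<open>The remaining maturities \<open>T - t\<close> and \<open>T' - t\<close>
          again differ by \<open>T' - T\<close>, and \<open>t \<le> \<tau> \<omega> \<le> T\<close>
          puts \<open>T - t\<close> into the range of the hypothesis.\<close>
        show "f y (T - t) \<le> g y (T' - t) + ennreal c" if "0 \<le> y" for y
          using le[OF that, of "T - t"] \<open>0 \<le> t\<close> \<open>t \<le> \<tau> \<omega>\<close> \<tau>\<omega> by (simp add: algebra_simps)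
      qed simp
      have "I f \<tau> T \<omega> \<le> (\<integral>\<^sup>+t. D t * P_op \<nu> g (x * H t \<omega>) (T' - t) * indicator {0..\<tau> \<omega>} t
          + ennreal c * (D t * indicator {0..\<tau> \<omega>} t) \<partial>lborel)"
        unfolding I_def
      proof (intro nn_integral_mono)
        fix t
        show "D t * P_op \<nu> f (x * H t \<omega>) (T - t) * indicator {0..\<tau> \<omega>} t
          \<le> D t * P_op \<nu> g (x * H t \<omega>) (T' - t) * indicator {0..\<tau> \<omega>} t
            + ennreal c * (D t * indicator {0..\<tau> \<omega>} t)"
          using mult_left_mono[OF P[of t], of "D t"]
          by (auto simp: indicator_def distrib_left mult.commute)
      qed
      \<comment> \<open>The error term is finite and measurable, so it can be split off although the
        integrand of \<open>I g\<close> may not be measurable.\<close>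
      also have "\<dots> \<le> I g \<tau> T' \<omega> + (\<integral>\<^sup>+t. ennreal c * (D t * indicator {0..\<tau> \<omega>} t) \<partial>lborel)"
        unfolding I_def
        by (intro nn_integral_add_le)
          (auto simp: indicator_def D_def ennreal_mult_less_top)
      also have "(\<integral>\<^sup>+t. ennreal c * (D t * indicator {0..\<tau> \<omega>} t) \<partial>lborel)
          = ennreal c * ennreal (lam / (r + lam) * (1 - exp (- (r + lam) * \<tau> \<omega>)))"
        using nn_integral_exp_discount[of "r + lam" lam "\<tau> \<omega>"] r lam \<tau>\<omega>
        by (subst nn_integral_cmult) (auto simp: D_def)
      also have "\<dots> = ennreal (lam / (lam + r) * (1 - exp (- (r + lam) * \<tau> \<omega>)) * c)"
        using c discount_factor_nonneg[OF \<tau>\<omega>(1)]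
        by (subst ennreal_mult[symmetric]) (simp_all only: ac_simps)
      \<comment> \<open>The factor increases with its time argument and
        \<open>\<tau> \<omega> \<le> T \<le> T0\<close>, so the bound becomes independent of
        \<omega>.\<close>
      also have "\<dots> \<le> C"
        unfolding C_def using c r lam \<tau>\<omega> T
        by (intro ennreal_leI mult_right_mono mult_left_mono diff_left_mono discount_antimono) auto
      finally show ?thesis by (simp add: add_left_mono)
    qed
    have "(\<integral>\<^sup>+\<omega>. (I f \<tau> T \<omega> + S \<tau> \<omega>) \<partial>M) \<le> (\<integral>\<^sup>+\<omega>. ((I g \<tau> T' \<omega> + S \<tau> \<omega>) + C) \<partial>M)"
    proof (intro nn_integral_mono)
      fix \<omega>
      assume "\<omega> \<in> space M"
      from add_right_mono[OF I[OF this], of "S \<tau> \<omega>"]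
      show "I f \<tau> T \<omega> + S \<tau> \<omega> \<le> (I g \<tau> T' \<omega> + S \<tau> \<omega>) + C"
        by (simp add: ac_simps)
    qed
    also have "\<dots> \<le> (\<integral>\<^sup>+\<omega>. (I g \<tau> T' \<omega> + S \<tau> \<omega>) \<partial>M) + (\<integral>\<^sup>+\<omega>. C \<partial>M)"
      by (intro nn_integral_add_le) (auto simp: C_def)
    also have "(\<integral>\<^sup>+\<omega>. C \<partial>M) = C"
      by (simp add: emeasure_space_1)
    \<comment> \<open>The admissible stopping times depend on neither integrand, and those bounded
      by \<open>T\<close> are also bounded by \<open>T'\<close>.\<close>
    also have "(\<integral>\<^sup>+\<omega>. (I g \<tau> T' \<omega> + S \<tau> \<omega>) \<partial>M) \<le> J_op M W \<nu> r \<sigma> lam K g x T'"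
      unfolding J using \<tau> stopping_times_mono[OF T(1)] by (intro SUP_upper) auto
    finally show ?thesis by (simp add: add_right_mono)
  qed
  then show ?thesis
    unfolding J[of f] C_def[symmetric] by (intro SUP_least)
qed

text \<open>With \<open>E\<close> the discount at the stopping time, the running reward is at most
  \<open>K * lam / (r + lam) * (1 - E)\<close>, hence at most \<open>K * (1 - E)\<close>, and the
  stopping reward is at most \<open>K * E\<close>. The two bounds add up to
  \<open>K\<close>.\<close>

lemma J_op_le:
  assumes x: "0 \<le> x" and le: "\<And>y s. 0 \<le> y \<Longrightarrow> 0 \<le> s \<Longrightarrow> f y s \<le> ennreal K"
  shows "J_op M W \<nu> r \<sigma> lam K f x T \<le> ennreal K"
  unfolding J_op_def Let_def
proof (intro SUP_least)
  define H where "H = H_proc W (drift \<nu> r lam) \<sigma>"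
  define D where "D = (\<lambda>t. ennreal (exp (- (r + lam) * t) * lam))"
  fix \<tau>
  assume \<tau>: "\<tau> \<in> stopping_times M (\<lambda>t \<omega>. x * H_proc W (drift \<nu> r lam) \<sigma> t \<omega>) T"
  have xH: "0 \<le> x * H t \<omega>" for t \<omega>
    using x H_proc_pos[of W "drift \<nu> r lam" \<sigma> t \<omega>] by (simp add: H_def)
  have [measurable]: "D \<in> borel_measurable borel"
    unfolding D_def by measurable
  have "(\<integral>\<^sup>+\<omega>. ((\<integral>\<^sup>+t\<in>{0..\<tau> \<omega>}. D t * P_op \<nu> f (x * H t \<omega>) (T - t) \<partial>lborel)
      + ennreal (exp (- (r + lam) * \<tau> \<omega>) * put_payoff K (x * H (\<tau> \<omega>) \<omega>))) \<partial>M) \<le> (\<integral>\<^sup>+\<omega>. ennreal K \<partial>M)"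
  proof (intro nn_integral_mono)
    fix \<omega>
    assume \<omega>: "\<omega> \<in> space M"
    have \<tau>\<omega>: "0 \<le> \<tau> \<omega>" "\<tau> \<omega> \<le> T"
      using \<tau> \<omega> by (auto simp: stopping_times_def)
    define E where "E = exp (- (r + lam) * \<tau> \<omega>)"
    have E: "0 \<le> E" "E \<le> 1"
      using discount_le_one[OF \<tau>\<omega>(1)] by (auto simp: E_def)
    have "(\<integral>\<^sup>+t\<in>{0..\<tau> \<omega>}. D t * P_op \<nu> f (x * H t \<omega>) (T - t) \<partial>lborel)
        \<le> (\<integral>\<^sup>+t. ennreal K * (D t * indicator {0..\<tau> \<omega>} t) \<partial>lborel)"
    proof (intro nn_integral_mono)
      fix t
      have "P_op \<nu> f (x * H t \<omega>) (T - t) \<le> ennreal K" if "0 \<le> t" "t \<le> \<tau> \<omega>"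
        using that \<tau>\<omega> le by (intro P_op_le \<nu> xH) auto
      then show "D t * P_op \<nu> f (x * H t \<omega>) (T - t) * indicator {0..\<tau> \<omega>} t
          \<le> ennreal K * (D t * indicator {0..\<tau> \<omega>} t)"
        by (auto simp: indicator_def mult.commute intro!: mult_left_mono)
    qed
    also have "\<dots> = ennreal K * ennreal (lam / (r + lam) * (1 - E))"
      using nn_integral_exp_discount[of "r + lam" lam "\<tau> \<omega>"] r lam \<tau>\<omega>
      by (subst nn_integral_cmult) (auto simp: D_def E_def)
    also have "\<dots> = ennreal (K * (lam / (r + lam) * (1 - E)))"
      using K r lam E by (subst ennreal_mult) auto
    also have "\<dots> \<le> ennreal (K * (1 - E))"
      using K r lam E by (intro ennreal_leI mult_left_mono mult_left_le_one_le) auto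
    finally have "(\<integral>\<^sup>+t\<in>{0..\<tau> \<omega>}. D t * P_op \<nu> f (x * H t \<omega>) (T - t) \<partial>lborel)
        + ennreal (E * put_payoff K (x * H (\<tau> \<omega>) \<omega>)) \<le> ennreal (K * (1 - E)) + ennreal (E * K)"
      using E K by (intro add_mono ennreal_leI mult_left_mono put_payoff_le xH) auto
    also have "\<dots> = ennreal K"
      using E K by (subst ennreal_plus[symmetric]) (auto simp: algebra_simps)
    finally show "(\<integral>\<^sup>+t\<in>{0..\<tau> \<omega>}. D t * P_op \<nu> f (x * H t \<omega>) (T - t) \<partial>lborel)
        + ennreal (exp (- (r + lam) * \<tau> \<omega>) * put_payoff K (x * H (\<tau> \<omega>) \<omega>)) \<le> ennreal K"
      by (simp add: E_def)
  qed
  also have "\<dots> = ennreal K"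
    by (simp add: emeasure_space_1)
  finally show "(\<integral>\<^sup>+\<omega>. ((\<integral>\<^sup>+t\<in>{0..\<tau> \<omega>}. ennreal (exp (- (r + lam) * t) * lam)
        * P_op \<nu> f (x * H_proc W (drift \<nu> r lam) \<sigma> t \<omega>) (T - t) \<partial>lborel)
      + ennreal (exp (- (r + lam) * \<tau> \<omega>)
        * put_payoff K (x * H_proc W (drift \<nu> r lam) \<sigma> (\<tau> \<omega>) \<omega>))) \<partial>M) \<le> ennreal K"
    by (simp add: H_def D_def)
qed

text \<open>Stopping at once earns the payoff at the starting point, whatever \<open>f\<close> is.
  This starts the induction showing that the iterates increase in \<open>n\<close>.\<close>

lemma put_payoff_le_J_op:
  assumes "0 \<le> T"
  shows "ennreal (put_payoff K x) \<le> J_op M W \<nu> r \<sigma> lam K f x T"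
proof -
  define H where "H = H_proc W (drift \<nu> r lam) \<sigma>"
  have "(\<lambda>_. 0) \<in> stopping_times M (\<lambda>t \<omega>. x * H t \<omega>) T"
    using assms by (auto simp: stopping_times_def stopping_time_def)
  then have stop_at_0: "(\<integral>\<^sup>+\<omega>. ((\<integral>\<^sup>+t\<in>{0..0}. ennreal (exp (- (r + lam) * t) * lam)
        * P_op \<nu> f (x * H t \<omega>) (T - t) \<partial>lborel)
      + ennreal (exp (- (r + lam) * 0) * put_payoff K (x * H 0 \<omega>))) \<partial>M)
      \<le> J_op M W \<nu> r \<sigma> lam K f x T"
    unfolding J_op_def Let_def H_def by (rule SUP_upper2) simp
  have "ennreal (put_payoff K x) = (\<integral>\<^sup>+\<omega>. ennreal (put_payoff K x) \<partial>M)"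
    by (simp add: emeasure_space_1)
  \<comment> \<open>\<open>W 0\<close> vanishes only almost surely, so
    \<open>x * H 0 \<omega> = x\<close> holds off a null set.\<close>
  also have "\<dots> \<le> (\<integral>\<^sup>+\<omega>. ((\<integral>\<^sup>+t\<in>{0..0}. ennreal (exp (- (r + lam) * t) * lam)
        * P_op \<nu> f (x * H t \<omega>) (T - t) \<partial>lborel)
      + ennreal (exp (- (r + lam) * 0) * put_payoff K (x * H 0 \<omega>))) \<partial>M)"
    using start_W by (intro nn_integral_mono_AE) (auto simp: H_def H_proc_def)
  also note stop_at_0
  finally show ?thesis .
qed

section \<open>The iterates at finite maturities: bound, monotonicity and error estimates\<close>

lemma v_finite_le: "0 \<le> x \<Longrightarrow> 0 \<le> T \<Longrightarrow> v_finite M W \<nu> r \<sigma> lam K n x T \<le> ennreal K"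
proof (induction n arbitrary: x T)
  case 0
  then show ?case using K by (auto intro!: ennreal_leI put_payoff_le)
next
  case (Suc n)
  then show ?case by (auto intro!: J_op_le)
qed

text \<open>The induction step is \<open>J_op_add_le\<close> with \<open>c = 0\<close>: a longer
  horizon admits more stopping times and leaves more time at each moment. This yields the limit at
  maturity infinity.\<close>

lemma v_finite_mono:
  "0 \<le> x \<Longrightarrow> 0 \<le> T \<Longrightarrow> T \<le> T' \<Longrightarrow>
    v_finite M W \<nu> r \<sigma> lam K n x T \<le> v_finite M W \<nu> r \<sigma> lam K n x T'"
proof (induction n arbitrary: x T T')
  case (Suc n)
  have "J_op M W \<nu> r \<sigma> lam K (v_finite M W \<nu> r \<sigma> lam K n) x T
      \<le> J_op M W \<nu> r \<sigma> lam K (v_finite M W \<nu> r \<sigma> lam K n) x T'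
        + ennreal (lam / (lam + r) * (1 - exp (- (r + lam) * T)) * 0)"
  proof (rule J_op_add_le)
    fix y s :: real
    assume "0 \<le> y" "0 \<le> s"
    then show "v_finite M W \<nu> r \<sigma> lam K n y s \<le> v_finite M W \<nu> r \<sigma> lam K n y (s + (T' - T)) + ennreal 0"
      using Suc.IH[of y s "s + (T' - T)"] Suc.prems by simp
  qed (use Suc.prems in simp_all)
  then show ?case by simp
qed simp

text \<open>Both sides are n-fold applications of J, to the iterates \<open>m\<close> and 0.
  \<open>T0\<close> stays fixed while \<open>T\<close> varies, because J evaluates the previous
  iterate at all shorter maturities and every step must have the same factor.\<close>

lemma v_finite_contraction:
  assumes "0 \<le> x" "0 \<le> T" "T \<le> T0"
  shows "v_finite M W \<nu> r \<sigma> lam K (m + n) x T \<le> v_finite M W \<nu> r \<sigma> lam K n x T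
    + ennreal ((lam / (lam + r) * (1 - exp (- (r + lam) * T0))) ^ n * K)"
  using assms
proof (induction n arbitrary: x T)
  case 0
  then have "v_finite M W \<nu> r \<sigma> lam K m x T \<le> 0 + ennreal K"
    using v_finite_le by simp
  also have "\<dots> \<le> ennreal (put_payoff K x) + ennreal K"
    by (intro add_right_mono) simp
  finally show ?case by simp
next
  case (Suc n)
  define q where "q = lam / (lam + r) * (1 - exp (- (r + lam) * T0))"
  have q: "0 \<le> q"
    unfolding q_def using Suc.prems by (intro discount_factor_nonneg) auto
  have "J_op M W \<nu> r \<sigma> lam K (v_finite M W \<nu> r \<sigma> lam K (m + n)) x T
      \<le> J_op M W \<nu> r \<sigma> lam K (v_finite M W \<nu> r \<sigma> lam K n) x T
        + ennreal (q * (q ^ n * K))"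
    unfolding q_def
  proof (rule J_op_add_le)
    show "0 \<le> (lam / (lam + r) * (1 - exp (- (r + lam) * T0))) ^ n * K"
      using q K by (simp add: q_def)
    fix y s :: real
    assume "0 \<le> y" "0 \<le> s" "s \<le> T"
    then show "v_finite M W \<nu> r \<sigma> lam K (m + n) y s \<le> v_finite M W \<nu> r \<sigma> lam K n y (s + (T - T))
        + ennreal ((lam / (lam + r) * (1 - exp (- (r + lam) * T0))) ^ n * K)"
      using Suc.IH[of y s] Suc.prems by simp
  qed (use Suc.prems in simp_all)
  then show ?case by (simp add: q_def mult.assoc)
qed

text \<open>Immediate stopping gives the first inequality, and monotonicity of J
  (\<open>c = 0\<close>, equal maturities) carries it on.\<close>

lemma v_finite_le_Suc:
  "0 \<le> x \<Longrightarrow> 0 \<le> T \<Longrightarrow> v_finite M W \<nu> r \<sigma> lam K n x T \<le> v_finite M W \<nu> r \<sigma> lam K (Suc n) x T"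
proof (induction n arbitrary: x T)
  case 0
  then show ?case by (simp add: put_payoff_le_J_op)
next
  case (Suc n)
  have "J_op M W \<nu> r \<sigma> lam K (v_finite M W \<nu> r \<sigma> lam K n) x T
      \<le> J_op M W \<nu> r \<sigma> lam K (v_finite M W \<nu> r \<sigma> lam K (Suc n)) x T
        + ennreal (lam / (lam + r) * (1 - exp (- (r + lam) * T)) * 0)"
  proof (rule J_op_add_le)
    fix y s :: real
    assume "0 \<le> y" "0 \<le> s"
    then show "v_finite M W \<nu> r \<sigma> lam K n y s
        \<le> v_finite M W \<nu> r \<sigma> lam K (Suc n) y (s + (T - T)) + ennreal 0"
      using Suc.IH[of y s] by simp
  qed (use Suc.prems in simp_all)
  then show ?case by simp
qed

text \<open>Since the iterates increase in their index, iterate \<open>m\<close> lies below iterate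
  \<open>m + n\<close>. The estimate thus holds for every \<open>m\<close>, and a supremum over
  \<open>m\<close> can be taken.\<close>

lemma v_finite_le_add:
  assumes "0 \<le> x" "0 \<le> T" "T \<le> T0"
  shows "v_finite M W \<nu> r \<sigma> lam K m x T \<le> v_finite M W \<nu> r \<sigma> lam K n x T
    + ennreal ((lam / (lam + r) * (1 - exp (- (r + lam) * T0))) ^ n * K)"
proof -
  have "v_finite M W \<nu> r \<sigma> lam K m x T \<le> v_finite M W \<nu> r \<sigma> lam K (m + n) x T"
    by (rule lift_Suc_mono_le[of "\<lambda>n. v_finite M W \<nu> r \<sigma> lam K n x T",
          OF v_finite_le_Suc[OF assms(1,2)]]) simp
  also note v_finite_contraction[OF assms]
  finally show ?thesis .
qed

text \<open>Taking \<open>T0 = T\<close> and dropping the exponential makes the error independent of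
  \<open>T\<close>, so that it survives the passage to maturity infinity.\<close>

lemma v_finite_le_add_geometric:
  assumes "0 \<le> x" "0 \<le> T"
  shows "v_finite M W \<nu> r \<sigma> lam K m x T \<le> v_finite M W \<nu> r \<sigma> lam K n x T
    + ennreal ((lam / (lam + r)) ^ n * K)"
proof -
  have "v_finite M W \<nu> r \<sigma> lam K m x T \<le> v_finite M W \<nu> r \<sigma> lam K n x T
      + ennreal ((lam / (lam + r) * (1 - exp (- (r + lam) * T))) ^ n * K)"
    using assms by (intro v_finite_le_add) auto
  also have "\<dots> \<le> v_finite M W \<nu> r \<sigma> lam K n x T + ennreal ((lam / (lam + r)) ^ n * K)"
    using assms K
    by (intro add_left_mono ennreal_leI mult_right_mono power_mono discount_factor_le
        discount_factor_nonneg) auto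
  finally show ?thesis .
qed

section \<open>Maturity infinity and the supremum over the iterates\<close>

text \<open>\<open>Lim\<close> in the definition of \<open>v\<close> says something only once a
  limit exists. By monotonicity in the maturity the values converge to their supremum over
  \<open>T \<ge> 0\<close>.\<close>

lemma v_finite_tendsto:
  assumes "0 \<le> x"
  shows "(v_finite M W \<nu> r \<sigma> lam K n x \<longlongrightarrow> v M W \<nu> r \<sigma> lam K n x \<infinity>) at_top"
proof -
  let ?f = "v_finite M W \<nu> r \<sigma> lam K n x"
  have "(?f \<longlongrightarrow> (SUP T\<in>{0..}. ?f T)) at_top"
  proof (rule increasing_tendsto)
    show "\<forall>\<^sub>F T in at_top. ?f T \<le> (SUP T\<in>{0..}. ?f T)"
      using eventually_ge_at_top[of "0::real"] by eventually_elim (auto intro: SUP_upper)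
    fix l
    assume "l < (SUP T\<in>{0..}. ?f T)"
    then obtain T where "0 \<le> T" "l < ?f T"
      by (auto simp: less_SUP_iff)
    then show "\<forall>\<^sub>F T in at_top. l < ?f T"
      using v_finite_mono[OF assms \<open>0 \<le> T\<close>]
      by (intro eventually_mono[OF eventually_ge_at_top[of T]]) (rule less_le_trans)
  qed
  then show ?thesis
    by (simp add: v_def tendsto_Lim)
qed

lemma v_le:
  assumes x: "0 \<le> x"
  shows "v M W \<nu> r \<sigma> lam K n x T \<le> ennreal K"
proof (cases "T = \<infinity>")
  case True
  have "v M W \<nu> r \<sigma> lam K n x \<infinity> \<le> ennreal K"
    using v_finite_tendsto[OF x]
  proof (rule tendsto_upperbound)
    show "\<forall>\<^sub>F T in at_top. v_finite M W \<nu> r \<sigma> lam K n x T \<le> ennreal K"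
      using eventually_ge_at_top[of "0::real"] by eventually_elim (rule v_finite_le[OF x])
  qed simp
  with True show ?thesis by simp
next
  case False
  then show ?thesis by (simp add: v_def v_finite_le x)
qed

lemma v_inf_less_top:
  assumes "0 \<le> x"
  shows "v_inf M W \<nu> r \<sigma> lam K x T < \<infinity>"
proof -
  have "v_inf M W \<nu> r \<sigma> lam K x T \<le> ennreal K"
    unfolding v_inf_def by (rule SUP_least) (rule v_le[OF assms])
  also have "\<dots> < \<infinity>"
    by simp
  finally show ?thesis .
qed

lemma v_le_v_inf: "v M W \<nu> r \<sigma> lam K n x T \<le> v_inf M W \<nu> r \<sigma> lam K x T"
  unfolding v_inf_def by (rule SUP_upper) simp

text \<open>A maturity below \<open>ennreal T0\<close> is finite, so the estimate for finite
  maturities applies with its factor depending on \<open>T0\<close>.\<close>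

lemma v_inf_le_add:
  assumes x: "0 \<le> x" and T0: "0 \<le> T0" "T \<le> ennreal T0"
  shows "v_inf M W \<nu> r \<sigma> lam K x T \<le> v M W \<nu> r \<sigma> lam K n x T
    + ennreal ((lam / (lam + r) * (1 - exp (- (r + lam) * T0))) ^ n * K)"
proof -
  have "T \<noteq> \<infinity>" "enn2real T \<le> T0"
    using T0 by (auto simp: top_unique enn2real_leI)
  then show ?thesis
    unfolding v_inf_def using v_finite_le_add[OF x, of "enn2real T" T0]
    by (intro SUP_least) (simp add: v_def)
qed

lemma v_inf_le_add_geometric:
  assumes x: "0 \<le> x"
  shows "v_inf M W \<nu> r \<sigma> lam K x T \<le> v M W \<nu> r \<sigma> lam K n x T
    + ennreal ((lam / (lam + r)) ^ n * K)"
  unfolding v_inf_def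
proof (intro SUP_least)
  fix m
  show "v M W \<nu> r \<sigma> lam K m x T \<le> v M W \<nu> r \<sigma> lam K n x T
    + ennreal ((lam / (lam + r)) ^ n * K)"
  proof (cases "T = \<infinity>")
    case True
    \<comment> \<open>The estimate for finite maturities is passed to the limit on both sides; its
      error term is constant in the maturity.\<close>
    have "v M W \<nu> r \<sigma> lam K m x \<infinity> \<le> v M W \<nu> r \<sigma> lam K n x \<infinity>
        + ennreal ((lam / (lam + r)) ^ n * K)"
      by (rule tendsto_le[OF _ tendsto_add[OF v_finite_tendsto[OF x] tendsto_const]
            v_finite_tendsto[OF x]])
        (auto intro!: eventually_mono[OF eventually_ge_at_top[of "0::real"]]
          v_finite_le_add_geometric x)
    with True show ?thesis by simp
  next
    case False
    then show ?thesis by (simp add: v_def v_finite_le_add_geometric x)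
  qed
qed

end

text \<open>For \<open>r = 0\<close> the ratio \<open>lam / (lam + r)\<close> is 1 and the geometric
  bound does not decay, so uniform convergence over all maturities is stated for
  \<open>0 < r\<close>. On bounded maturities it is stated for every
  \<open>r \<ge> 0\<close>.\<close>

theorem lemma3p2:
  fixes M :: "'a measure" and W :: "real \<Rightarrow> 'a \<Rightarrow> real" and \<nu> :: "real measure"
    and r \<sigma> lam K :: real
  assumes W: "wiener_process M W"
    and \<nu>: "prob_space \<nu>" "sets \<nu> = sets borel" "AE z in \<nu>. 0 < z"
    and \<xi>: "set_integrable \<nu> {0..} (\<lambda>z. z)"
    and r: "0 \<le> r" and \<sigma>: "0 < \<sigma>" and lam: "0 < lam" and K: "0 < K"
  shows "(0 < r \<longrightarrow>
           uniform_limit ({0..} \<times> UNIV)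
             (\<lambda>n (x, T). enn2real (v M W \<nu> r \<sigma> lam K n x T))
             (\<lambda>(x, T). enn2real (v_inf M W \<nu> r \<sigma> lam K x T)) sequentially) \<and>
         (\<forall>T0 :: real. 0 \<le> T0 \<longrightarrow>
           uniform_limit ({0..} \<times> {..ennreal T0})
             (\<lambda>n (x, T). enn2real (v M W \<nu> r \<sigma> lam K n x T))
             (\<lambda>(x, T). enn2real (v_inf M W \<nu> r \<sigma> lam K x T)) sequentially) \<and>
         (\<forall>n. \<forall>x\<ge>0. \<forall>T :: ennreal.
           v M W \<nu> r \<sigma> lam K n x T \<le> v_inf M W \<nu> r \<sigma> lam K x T \<and>
           v_inf M W \<nu> r \<sigma> lam K x T
             \<le> v M W \<nu> r \<sigma> lam K n x T + ennreal ((lam / (lam + r)) ^ n * K))"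
proof (intro conjI impI allI)
  note ctx = W \<nu>(1,2) r lam K
  show "uniform_limit ({0..} \<times> UNIV)
      (\<lambda>n (x, T). enn2real (v M W \<nu> r \<sigma> lam K n x T))
      (\<lambda>(x, T). enn2real (v_inf M W \<nu> r \<sigma> lam K x T)) sequentially" if "0 < r"
    unfolding case_prod_beta
  proof (rule uniform_limit_enn2real_geometric)
    show "0 \<le> lam / (lam + r)" "lam / (lam + r) < 1" "0 \<le> K"
      using lam K that by auto
    fix y :: "real \<times> ennreal"
    assume "y \<in> {0..} \<times> UNIV"
    then have y: "0 \<le> fst y"
      by auto
    show "v_inf M W \<nu> r \<sigma> lam K (fst y) (snd y) < \<infinity>"
      using y by (rule v_inf_less_top[OF ctx])
    show "v M W \<nu> r \<sigma> lam K n (fst y) (snd y) \<le> v_inf M W \<nu> r \<sigma> lam K (fst y) (snd y)" for n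
      by (rule v_le_v_inf[OF ctx])
    show "v_inf M W \<nu> r \<sigma> lam K (fst y) (snd y)
      \<le> v M W \<nu> r \<sigma> lam K n (fst y) (snd y) + ennreal ((lam / (lam + r)) ^ n * K)" for n
      using y by (rule v_inf_le_add_geometric[OF ctx])
  qed
  show "uniform_limit ({0..} \<times> {..ennreal T0})
      (\<lambda>n (x, T). enn2real (v M W \<nu> r \<sigma> lam K n x T))
      (\<lambda>(x, T). enn2real (v_inf M W \<nu> r \<sigma> lam K x T)) sequentially" if "0 \<le> T0" for T0
    unfolding case_prod_beta
  proof (rule uniform_limit_enn2real_geometric)
    show "0 \<le> lam / (lam + r) * (1 - exp (- (r + lam) * T0))"
      using that by (rule discount_factor_nonneg[OF ctx])
    show "0 \<le> K"
      using K by simp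
    \<comment> \<open>Strictness comes from the exponential, since \<open>lam / (lam + r)\<close>
      itself may equal 1.\<close>
    have "lam / (lam + r) * (1 - exp (- (r + lam) * T0)) \<le> 1 * (1 - exp (- (r + lam) * T0))"
      using lam r discount_le_one[OF ctx that] by (intro mult_right_mono) auto
    also have "\<dots> < 1"
      by simp
    finally show "lam / (lam + r) * (1 - exp (- (r + lam) * T0)) < 1" .
    fix y :: "real \<times> ennreal"
    assume "y \<in> {0..} \<times> {..ennreal T0}"
    then have y: "0 \<le> fst y" "snd y \<le> ennreal T0"
      by auto
    show "v_inf M W \<nu> r \<sigma> lam K (fst y) (snd y) < \<infinity>"
      using y(1) by (rule v_inf_less_top[OF ctx])
    show "v M W \<nu> r \<sigma> lam K n (fst y) (snd y) \<le> v_inf M W \<nu> r \<sigma> lam K (fst y) (snd y)" for n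
      by (rule v_le_v_inf[OF ctx])
    show "v_inf M W \<nu> r \<sigma> lam K (fst y) (snd y) \<le> v M W \<nu> r \<sigma> lam K n (fst y) (snd y)
      + ennreal ((lam / (lam + r) * (1 - exp (- (r + lam) * T0))) ^ n * K)" for n
      by (rule v_inf_le_add[OF ctx y(1) that y(2)])
  qed
  show "v M W \<nu> r \<sigma> lam K n x T \<le> v_inf M W \<nu> r \<sigma> lam K x T" for n x T
    by (rule v_le_v_inf[OF ctx])
  show "v_inf M W \<nu> r \<sigma> lam K x T
      \<le> v M W \<nu> r \<sigma> lam K n x T + ennreal ((lam / (lam + r)) ^ n * K)" if "0 \<le> x" for n x T
    using that by (rule v_inf_le_add_geometric[OF ctx])
qed

end
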